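(* Let $A,B,C$ be points of the Euclidean plane with position vectors $a,b,c$, let $Z$ be their center of gravity, with position vector $z=\frac13(a+b+c)$, and let $H(x)=\|x-a\|^2+\|x-b\|^2+\|x-c\|^2$. Let $0<R_A^-<R_A$, $0<R_B^-<R_B$, $0<R_C^-<R_C$ and $$W=\{X\in\mathbb{R}^2: R_A^-\le|XA|\le R_A,\ R_B^-\le|XB|\le R_B,\ R_C^-\le|XC|\le R_C\}.$$ Assume that the closed discs of radii $R_A^-,R_B^-,R_C^-$ centered at $A,B,C$ respectively are pairwise disjoint and contained in the interior of the intersection of the closed discs of radii $R_A,R_B,R_C$ centered at $A,B,C$ (so that $W$ is a disc with three holes), and that $W$ contains an open neighborhood of $Z$. Then $Z$ is an absolute minimum of $H$ on $W$. Moreover, there are $3$ saddle points of $H$ on $W$, located at the outer intersection points of the three small circles (of radii $R_A^-,R_B^-,R_C^-$ centered at $A,B,C$) with the lines $ZA$, $ZB$, $ZC$ respectively.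
   Context: Of the two intersection points of the line $ZA$ with the circle of radius $R_A^-$ centered at $A$, the outer one is the one farther from $Z$; similarly for $B$ and $C$. Critical points are understood in the sense of Morse theory on manifolds with boundary. A point $p$ on a smooth part of $\partial W$ is a (boundary) saddle point of $H$ on $W$ if $\nabla H(p)\neq0$, the restriction of $H$ to the boundary curve has a nondegenerate local maximum at $p$, and $\nabla H(p)$ points into $W$ (so that passing $p$ attaches a $1$-cell to the sublevel set $\{x\in W: H(x)\le t\}$). *)

theory Defs
  imports "HOL-Analysis.Analysis"
begin

text \<open>For open \<open>S\<close>, \<open>Ck_on k f S\<close> says that \<open>f\<close> is \<open>k\<close> times continuously (Frechet)
  differentiable on \<open>S\<close>.\<close>

primrec Ck_on ::
  "nat \<Rightarrow> ('a::euclidean_space \<Rightarrow> 'b::real_normed_vector) \<Rightarrow> 'a set \<Rightarrow> bool" where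
  "Ck_on 0 f S \<longleftrightarrow> continuous_on S f"
| "Ck_on (Suc k) f S \<longleftrightarrow>
     (\<exists>f'. (\<forall>x\<in>S. (f has_derivative f' x) (at x)) \<and> (\<forall>v. Ck_on k (\<lambda>x. f' x v) S))"

definition smooth_on ::
  "('a::euclidean_space \<Rightarrow> 'b::real_normed_vector) \<Rightarrow> 'a set \<Rightarrow> bool" where
  "smooth_on f S \<longleftrightarrow> (\<forall>k. Ck_on k f S)"

text \<open>Near \<open>p\<close>, the set \<open>W\<close> is a smooth surface with boundary: it is given by \<open>g \<le> 0\<close>, where
  \<open>n\<close>, the gradient of \<open>g\<close> at \<open>p\<close>, is a nonzero outward normal vector. This is what it means
  for \<open>p\<close> to lie on a smooth part of the boundary of \<open>W\<close>.\<close>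

definition smooth_boundary_at ::
  "(real^2) set \<Rightarrow> real^2 \<Rightarrow> (real^2) set \<Rightarrow> (real^2 \<Rightarrow> real) \<Rightarrow> real^2 \<Rightarrow> bool" where
  "smooth_boundary_at W p U g n \<longleftrightarrow>
     open U \<and> p \<in> U \<and> smooth_on g U \<and> g p = 0 \<and> GDERIV g p :> n \<and> n \<noteq> 0 \<and>
     W \<inter> U = {x \<in> U. g x \<le> 0}"

text \<open>Meant for points \<open>p\<close> on a smooth part of the boundary of \<open>W\<close>. There a smooth curve
  in \<open>frontier W\<close> with nonzero velocity at \<open>p\<close> parametrizes the boundary curve near \<open>p\<close>, and at
  a critical point the sign of the second derivative does not depend on the parametrization.\<close>

definition nondegenerate_max_on_boundary ::
  "(real^2) set \<Rightarrow> (real^2 \<Rightarrow> real) \<Rightarrow> real^2 \<Rightarrow> bool" where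
  "nondegenerate_max_on_boundary W H p \<longleftrightarrow>
     (\<exists>e \<gamma> u d s. 0 < e \<and> smooth_on \<gamma> {-e<..<e} \<and> \<gamma> ` {-e<..<e} \<subseteq> frontier W \<and> \<gamma> 0 = p \<and>
        (\<gamma> has_vector_derivative u) (at 0) \<and> u \<noteq> 0 \<and>
        (\<forall>t\<in>{-e<..<e}. ((H \<circ> \<gamma>) has_real_derivative d t) (at t)) \<and> d 0 = 0 \<and>
        (d has_real_derivative s) (at 0) \<and> s < 0)"

definition boundary_saddle ::
  "(real^2) set \<Rightarrow> (real^2 \<Rightarrow> real) \<Rightarrow> real^2 \<Rightarrow> bool" where
  "boundary_saddle W H p \<longleftrightarrow>
     (\<exists>U g n v. smooth_boundary_at W p U g n \<and> GDERIV H p :> v \<and> v \<noteq> 0 \<and> v \<bullet> n < 0) \<and>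
     nondegenerate_max_on_boundary W H p"

text \<open>\<open>D\<close> is the Hessian of \<open>H\<close> at the critical point \<open>p\<close>. In dimension two, a symmetric form is
  nondegenerate of index one iff it takes both negative and positive values.\<close>

definition interior_saddle ::
  "(real^2) set \<Rightarrow> (real^2 \<Rightarrow> real) \<Rightarrow> real^2 \<Rightarrow> bool" where
  "interior_saddle W H p \<longleftrightarrow>
     p \<in> interior W \<and>
     (\<exists>G D. (\<forall>\<^sub>F x in nhds p. GDERIV H x :> G x) \<and> G p = 0 \<and> (G has_derivative D) (at p) \<and>
        (\<exists>x. x \<bullet> D x < 0) \<and> (\<exists>y. 0 < y \<bullet> D y))"

definition saddle_point ::
  "(real^2) set \<Rightarrow> (real^2 \<Rightarrow> real) \<Rightarrow> real^2 \<Rightarrow> bool" where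
  "saddle_point W H p \<longleftrightarrow> interior_saddle W H p \<or> boundary_saddle W H p"

definition outer_intersection :: "real^2 \<Rightarrow> real^2 \<Rightarrow> real \<Rightarrow> real^2 \<Rightarrow> bool" where
  "outer_intersection z a r p \<longleftrightarrow>
     p \<in> affine hull {z, a} \<inter> sphere a r \<and>
     (\<forall>q \<in> affine hull {z, a} \<inter> sphere a r. q \<noteq> p \<longrightarrow> dist z q < dist z p)"

end

(* Up to an additive constant H is 3 |x - z|^2, so its gradient is 6 (x - z) and its Hessian is
   positive definite: z is the minimum and there are no interior saddles. On an outer circle the
   region is locally a convex set that contains z, so 6 (x - z) cannot point into it. On the
   circle of radius r about a, H equals 6 (x - a) . (a - z) up to a constant; its two critical
   points are a \<plusminus> (r / |a - z|) (a - z), the maximum being the outer one. *)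

theory Submission
  imports Defs
begin

section \<open>Smoothness of squared distances and of circular curves\<close>

lemma Ck_on_const: "Ck_on k (\<lambda>x. c) S"
proof (induction k arbitrary: c)
  case (Suc k)
  have "\<forall>x\<in>S. ((\<lambda>x. c) has_derivative (\<lambda>h. 0)) (at x)" by auto
  then show ?case using Suc[of 0] by (auto intro!: exI[of _ "\<lambda>x h. 0"])
qed simp

lemma Ck_on_affine: "Ck_on k (\<lambda>x. c + x \<bullet> w) S"
proof (cases k)
  case (Suc m)
  have "\<forall>x\<in>S. ((\<lambda>x. c + x \<bullet> w) has_derivative (\<lambda>h. h \<bullet> w)) (at x)"
    by (auto intro!: derivative_eq_intros)
  then show ?thesis unfolding Suc
    by (auto simp: Ck_on_const intro!: exI[of _ "\<lambda>x h. h \<bullet> w"])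
qed (auto intro!: continuous_intros)

lemma has_derivative_norm_diff_sq:
  fixes a :: "'a::real_inner"
  shows "((\<lambda>x. (norm (x - a))\<^sup>2) has_derivative (\<lambda>h. h \<bullet> (2 *\<^sub>R (x - a)))) (at x)"
  unfolding power2_norm_eq_inner
  by (auto intro!: derivative_eq_intros simp: inner_commute)

text \<open>One differentiation in a fixed direction leaves an affine function of the base point, so
  \<open>Ck_on_affine\<close> settles all higher orders.\<close>

lemma smooth_on_norm_diff_sq: "smooth_on (\<lambda>x. c - (norm (x - a))\<^sup>2) S"
  unfolding smooth_on_def
proof
  fix k
  show "Ck_on k (\<lambda>x. c - (norm (x - a))\<^sup>2) S"
  proof (cases k)
    case (Suc m)
    have D: "((\<lambda>x. c - (norm (x - a))\<^sup>2) has_derivative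
               (\<lambda>h. 2 * (a \<bullet> h) + x \<bullet> ((-2) *\<^sub>R h))) (at x)" for x
      using has_derivative_diff[OF has_derivative_const has_derivative_norm_diff_sq, of c a x]
      by (simp add: inner_diff_right inner_commute algebra_simps)
    show ?thesis unfolding Suc
      using D by (auto simp only: Ck_on.simps Ck_on_affine
          intro!: exI[of _ "\<lambda>x h. 2 * (a \<bullet> h) + x \<bullet> ((-2) *\<^sub>R h)"])
  qed (auto intro!: continuous_intros)
qed

lemma has_vector_derivative_ellipse:
  "((\<lambda>t. c + (cos t *\<^sub>R u + sin t *\<^sub>R w)) has_vector_derivative
     (cos t *\<^sub>R w + sin t *\<^sub>R (- u))) (at t)"
  by (auto intro!: derivative_eq_intros simp: has_vector_derivative_def scaleR_add_right algebra_simps)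

text \<open>These curves form a family closed under differentiation: applied to \<open>v\<close>,
  the derivative is again such a curve, with data \<open>0\<close>, \<open>v *\<^sub>R w\<close>,
  \<open>v *\<^sub>R (- u)\<close>. Hence the induction on the order with \<open>c\<close>,
  \<open>u\<close>, \<open>w\<close> arbitrary.\<close>

lemma smooth_on_ellipse:
  "smooth_on (\<lambda>t. c + (cos t *\<^sub>R u + sin t *\<^sub>R w)) S"
proof -
  have "Ck_on k (\<lambda>t. c + (cos t *\<^sub>R u + sin t *\<^sub>R w)) S" for k
  proof (induction k arbitrary: c u w)
    case (Suc k)
    have eq: "v *\<^sub>R (cos t *\<^sub>R w + sin t *\<^sub>R (- u)) = 0 + (cos t *\<^sub>R (v *\<^sub>R w) + sin t *\<^sub>R (v *\<^sub>R (- u)))"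
      for t v :: real by (simp add: algebra_simps)
    have "Ck_on k (\<lambda>t. v *\<^sub>R (cos t *\<^sub>R w + sin t *\<^sub>R (- u))) S" for v
      unfolding eq by (rule Suc)
    then show ?case
      using has_vector_derivative_ellipse[unfolded has_vector_derivative_def]
      by (auto simp only: Ck_on.simps intro!: exI[of _ "\<lambda>t v. v *\<^sub>R (cos t *\<^sub>R w + sin t *\<^sub>R (- u))"])
  qed (auto intro!: continuous_intros)
  then show ?thesis by (simp add: smooth_on_def)
qed

section \<open>Tools from calculus and plane linear algebra\<close>

text \<open>Since \<open>d\<close> vanishes at 0 with negative slope, it is negative just to the
  right of 0, and the mean value theorem makes \<open>f\<close> drop there. One side suffices to
  contradict a minimum later on.\<close>

lemma second_derivative_test_right:
  fixes f d :: "real \<Rightarrow> real"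
  assumes "0 < e" and f: "\<forall>t\<in>{-e<..<e}. (f has_real_derivative d t) (at t)"
    and "d 0 = 0" and "(d has_real_derivative s) (at 0)" and "s < 0"
  shows "\<exists>\<delta>>0. \<forall>t. 0 < t \<and> t < \<delta> \<longrightarrow> f t < f 0"
proof -
  obtain \<delta> where \<delta>: "0 < \<delta>" "\<And>h. 0 < h \<Longrightarrow> h < \<delta> \<Longrightarrow> d h < 0"
    using DERIV_neg_dec_right[OF assms(4,5)] assms(3) by auto
  have "f t < f 0" if t: "0 < t" "t < min \<delta> e" for t
  proof -
    obtain \<xi> where "0 < \<xi>" "\<xi> < t" "f t - f 0 = (t - 0) * d \<xi>"
      using MVT2[of 0 t f d] f t by auto
    then show ?thesis using \<delta>(2)[of \<xi>] t mult_pos_neg[of t "d \<xi>"] by auto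
  qed
  then show ?thesis using \<delta>(1) \<open>0 < e\<close> by (intro exI[of _ "min \<delta> e"]) auto
qed

text \<open>In the plane the vectors orthogonal to a nonzero \<open>u\<close> form a line, and
  \<open>y\<close> spans it.\<close>

lemma ortho_same_imp_scaleR:
  fixes x y u :: "real^2"
  assumes "x \<bullet> u = 0" "y \<bullet> u = 0" "u \<noteq> 0" "y \<noteq> 0"
  obtains l where "x = l *\<^sub>R y"
proof -
  have c: "x$1 * u$1 + x$2 * u$2 = 0" "y$1 * u$1 + y$2 * u$2 = 0"
    using assms by (auto simp: inner_vec_def sum_2)
  have u: "u$1 \<noteq> 0 \<or> u$2 \<noteq> 0" and y: "y$1 \<noteq> 0 \<or> y$2 \<noteq> 0"
    using assms by (auto simp: vec_eq_iff forall_2)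
  \<comment> \<open>Elimination between the two orthogonality relations: each coordinate of
    \<open>u\<close> annihilates the determinant of \<open>x\<close> and \<open>y\<close>.\<close>
  have "u$1 * (x$1 * y$2 - x$2 * y$1) = 0" "u$2 * (x$1 * y$2 - x$2 * y$1) = 0"
    using c by algebra+
  then have cr: "x$1 * y$2 = x$2 * y$1" using u by auto
  show ?thesis
  proof (cases "y$1 = 0")
    case True
    then show ?thesis using cr y
      by (intro that[of "x$2 / y$2"]) (auto simp: vec_eq_iff forall_2 field_simps)
  next
    case False
    then show ?thesis using cr
      by (intro that[of "x$1 / y$1"]) (auto simp: vec_eq_iff forall_2 field_simps)
  qed
qed

section \<open>The outer intersection point in closed form\<close>

definition outer_point :: "'a::real_normed_vector \<Rightarrow> 'a \<Rightarrow> real \<Rightarrow> 'a" where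
  "outer_point z a r = a + (r / norm (a - z)) *\<^sub>R (a - z)"

lemma outer_point_in_sphere:
  assumes "0 < r" "z \<noteq> a"
  shows "outer_point z a r \<in> sphere a r"
  using assms by (simp add: outer_point_def dist_norm)

text \<open>A point a + m (a - z) of the line is on the circle iff |m| = r / |a - z|, and its
  distance from \<open>z\<close> is |1 + m| |a - z|. Of the two signs of m the positive one
  therefore wins.\<close>

lemma outer_intersection_outer_point:
  fixes z a :: "real^2"
  assumes r: "0 < r" and za: "z \<noteq> a"
  shows "outer_intersection z a r (outer_point z a r)"
proof -
  let ?D = "norm (a - z)"
  have D: "0 < ?D" using za by simp
  have line: "a + \<mu> *\<^sub>R (a - z) \<in> affine hull {z, a}" for \<mu>
    unfolding affine_hull_2
    by (rule CollectI, rule exI[of _ "-\<mu>"], rule exI[of _ "1 + \<mu>"]) (simp add: algebra_simps)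
  have dz: "dist z (a + \<mu> *\<^sub>R (a - z)) = \<bar>1 + \<mu>\<bar> * ?D" for \<mu>
  proof -
    have "z - (a + \<mu> *\<^sub>R (a - z)) = (-(1 + \<mu>)) *\<^sub>R (a - z)" by (simp add: algebra_simps)
    then show ?thesis unfolding dist_norm by (simp only: norm_scaleR abs_minus_cancel)
  qed
  have "dist z q < dist z (outer_point z a r)"
    if q: "q \<in> affine hull {z, a}" "q \<in> sphere a r" "q \<noteq> outer_point z a r" for q
  proof -
    obtain u v where uv: "q = u *\<^sub>R z + v *\<^sub>R a" "u + v = 1"
      using q(1) unfolding affine_hull_2 by auto
    have v: "v = 1 - u" using uv(2) by simp
    have q': "q = a + (-u) *\<^sub>R (a - z)" unfolding uv(1) v by (simp add: algebra_simps)
    have "\<bar>u\<bar> * ?D = r" using q(2) unfolding q' by (simp add: dist_norm)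
    then have "\<bar>u\<bar> = r / ?D" using D by (simp add: field_simps)
    moreover have "-u \<noteq> r / ?D"
    proof
      assume "-u = r / ?D"
      then have "q = outer_point z a r" unfolding q' outer_point_def by (simp only:)
      then show False using q(3) by simp
    qed
    \<comment> \<open>In terms of \<open>u\<close> the parameter of \<open>q\<close> is -u; the
      positive root has just been excluded.\<close>
    ultimately have u: "u = r / ?D" by linarith
    have "0 < r / ?D" using r D by simp
    then have "\<bar>1 + (-u)\<bar> < \<bar>1 + r / ?D\<bar>" unfolding u by linarith
    then show ?thesis unfolding q' outer_point_def dz using D by simp
  qed
  then show ?thesis
    using outer_point_in_sphere[OF r za] line unfolding outer_intersection_def outer_point_def
    by blast
qed

section \<open>The gradient of \<open>H\<close>, and places where no saddle can occur\<close>

text \<open>The saddle definitions quantify gradients existentially; uniqueness identifies them with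
  6 (x - z).\<close>

lemma GDERIV_unique:
  assumes "GDERIV f x :> d" "GDERIV f x :> e"
  shows "d = e"
proof -
  have "(\<lambda>h. h \<bullet> d) = (\<lambda>h. h \<bullet> e)"
    using assms unfolding gderiv_def by (rule has_derivative_unique)
  then have "(d - e) \<bullet> d = (d - e) \<bullet> e" by metis
  then have "(d - e) \<bullet> (d - e) = 0" by (simp add: inner_diff_right)
  then show ?thesis by simp
qed

lemma GDERIV_compose_has_vector_derivative:
  assumes "(\<gamma> has_vector_derivative u) (at t)" "GDERIV f (\<gamma> t) :> v"
  shows "((\<lambda>s. f (\<gamma> s)) has_real_derivative u \<bullet> v) (at t)"
proof -
  have "((\<lambda>s. f (\<gamma> s)) has_derivative (\<lambda>h. (h *\<^sub>R u) \<bullet> v)) (at t)"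
    using assms unfolding has_vector_derivative_def gderiv_def by (rule has_derivative_compose)
  moreover have "(\<lambda>h. (h *\<^sub>R u) \<bullet> v) = (*) (u \<bullet> v)" by (auto simp: mult.commute)
  ultimately show ?thesis unfolding has_field_derivative_def by (simp only:)
qed

lemma gderiv_dist_sq:
  fixes z :: "'a::real_inner"
  assumes "H = (\<lambda>x. 3 * (norm (x - z))\<^sup>2 + k)"
  shows "GDERIV H x :> 6 *\<^sub>R (x - z)"
  unfolding gderiv_def assms
  using has_derivative_add[OF has_derivative_mult_right[OF has_derivative_norm_diff_sq[of z x], of 3]
      has_derivative_const[of k]]
  by (simp add: mult.assoc)

lemma no_interior_saddle_dist_sq:
  fixes z :: "real^2"
  assumes "H = (\<lambda>x. 3 * (norm (x - z))\<^sup>2 + k)"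
  shows "\<not> interior_saddle W H p"
proof
  assume "interior_saddle W H p"
  then obtain G D x where G: "\<forall>\<^sub>F x in nhds p. GDERIV H x :> G x"
    and D: "(G has_derivative D) (at p)" and x: "x \<bullet> D x < 0"
    unfolding interior_saddle_def by blast
  \<comment> \<open>\<open>G\<close> agrees with 6 (x - z) only near \<open>p\<close>, so the
    equality is first localized to an open set and the derivative transferred there. The Hessian is
    then 6 times the identity and has no negative direction.\<close>
  have "\<forall>\<^sub>F x in nhds p. G x = 6 *\<^sub>R (x - z)"
    using G by eventually_elim (rule GDERIV_unique[OF _ gderiv_dist_sq[OF assms]])
  then obtain S where S: "open S" "p \<in> S" "\<And>x. x \<in> S \<Longrightarrow> G x = 6 *\<^sub>R (x - z)"
    unfolding eventually_nhds by blast
  have "((\<lambda>x. 6 *\<^sub>R (x - z)) has_derivative D) (at p)"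
    by (rule has_derivative_transform_within_open[OF D S])
  moreover have "((\<lambda>x. 6 *\<^sub>R (x - z)) has_derivative (\<lambda>h. 6 *\<^sub>R h)) (at p)"
    by (auto intro!: derivative_eq_intros)
  ultimately have "D = (\<lambda>h. 6 *\<^sub>R h)" by (rule has_derivative_unique)
  then show False using x inner_ge_zero[of x] by simp
qed

lemma boundary_saddle_inD: "boundary_saddle W H p \<Longrightarrow> p \<in> W"
  unfolding boundary_saddle_def smooth_boundary_at_def by fastforce

text \<open>By convexity the segment from \<open>p\<close> to \<open>z\<close> starts inside
  \<open>W\<close>, so \<open>g\<close> cannot become positive on it at once. A gradient 6 (p - z)
  pointing into \<open>W\<close> would make z - p point outwards and \<open>g\<close> increase along
  this segment.\<close>

lemma no_boundary_saddle_locally_convex: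
  assumes H: "H = (\<lambda>x. 3 * (norm (x - z))\<^sup>2 + k)"
    and N: "open N" "p \<in> N" "W \<inter> N = K \<inter> N" and K: "convex K" "z \<in> K"
  shows "\<not> boundary_saddle W H p"
proof
  assume b: "boundary_saddle W H p"
  then obtain U g n v where U: "smooth_boundary_at W p U g n"
    and v: "GDERIV H p :> v" "v \<bullet> n < 0"
    unfolding boundary_saddle_def by blast
  have pK: "p \<in> K" using boundary_saddle_inD[OF b] N by blast
  have v6: "v = 6 *\<^sub>R (p - z)" by (rule GDERIV_unique[OF v(1) gderiv_dist_sq[OF H]])
  from U have oU: "open U" "p \<in> U" and g: "g p = 0" "GDERIV g p :> n"
    and WU: "W \<inter> U = {x \<in> U. g x \<le> 0}"
    unfolding smooth_boundary_at_def by auto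
  let ?l = "\<lambda>t::real. p + t *\<^sub>R (z - p)"
  have dl: "(?l has_vector_derivative (z - p)) (at 0)"
    by (auto intro!: derivative_eq_intros simp: has_vector_derivative_def)
  have dg: "((\<lambda>t. g (?l t)) has_real_derivative (z - p) \<bullet> n) (at 0)"
    using GDERIV_compose_has_vector_derivative[OF dl, of g n] g(2) by simp
  have pos: "0 < (z - p) \<bullet> n" using v(2) unfolding v6 by (simp add: inner_diff_left)
  obtain d where d: "0 < d" "\<And>h. 0 < h \<Longrightarrow> h < d \<Longrightarrow> 0 < g (?l h)"
    using DERIV_pos_inc_right[OF dg pos] g(1) by auto
  have "open (U \<inter> N)" using oU N by auto
  moreover have "isCont ?l 0" by (intro continuous_intros)
  then have "(?l \<longlongrightarrow> ?l 0) (nhds 0)"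
    unfolding isCont_def by (rule iffD1[OF tendsto_at_iff_tendsto_nhds[of ?l 0]])
  ultimately have "\<forall>\<^sub>F t in nhds 0. ?l t \<in> U \<inter> N"
    using topological_tendstoD[of ?l "?l 0" "nhds 0" "U \<inter> N"] oU N by auto
  then obtain e where e: "0 < e" "\<And>t. \<bar>t\<bar> < e \<Longrightarrow> ?l t \<in> U \<inter> N"
    unfolding eventually_nhds_metric by (auto simp: dist_norm)
  define t where "t = min (min d e) 1 / 2"
  have t: "0 < t" "t < d" "t < e" "t \<le> 1" using d(1) e(1) by (auto simp: t_def)
  have "?l t = (1 - t) *\<^sub>R p + t *\<^sub>R z" by (simp add: algebra_simps)
  then have "?l t \<in> K" using convexD_alt[OF K(1) pK K(2)] t by simp
  then have "?l t \<in> W \<inter> U" using e(2)[of t] t N by auto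
  then show False using WU d(2)[of t] t by auto
qed

section \<open>Local analysis at the boundary circle of one hole\<close>

lemma norm_diff_sq_split:
  fixes a x z :: "'a::real_inner"
  shows "(norm (x - z))\<^sup>2 = (norm (x - a))\<^sup>2 + 2 * ((x - a) \<bullet> (a - z)) + (norm (a - z))\<^sup>2"
proof -
  have "x - z = (x - a) + (a - z)" by simp
  then show ?thesis using dot_norm[of "x - a" "a - z"] by (simp add: field_simps)
qed

text \<open>On the circle the squared distance to \<open>z\<close> is a linear function of x - a
  plus a constant, which makes its extrema explicit.\<close>

lemma norm_sq_on_sphere:
  fixes a :: "'a::real_inner"
  assumes "x \<in> sphere a r"
  shows "(norm (x - z))\<^sup>2 = r\<^sup>2 + 2 * ((x - a) \<bullet> (a - z)) + (norm (a - z))\<^sup>2"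
  using norm_diff_sq_split[of x z a] assms by (simp add: dist_norm norm_minus_commute)

text \<open>Treats the three holes uniformly. \<open>N\<close> is a neighbourhood of the small
  circle on which no constraint of \<open>W\<close> other than that of this hole is felt.\<close>

locale hole =
  fixes W N :: "(real^2) set" and a z :: "real^2" and r k :: real and H
  assumes H: "H = (\<lambda>x. 3 * (norm (x - z))\<^sup>2 + k)"
    and r: "0 < r" and za: "z \<noteq> a"
    and N: "open N" "sphere a r \<subseteq> N" "W \<inter> N = {x \<in> N. r \<le> dist x a}"
begin

text \<open>Boundary curves are only assumed to run in \<open>frontier W\<close>; this puts them on
  the circle as long as they stay in \<open>N\<close>.\<close>

lemma frontier_iff:
  assumes x: "x \<in> N"
  shows "x \<in> frontier W \<longleftrightarrow> x \<in> sphere a r"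
proof
  assume f: "x \<in> frontier W"
  have "\<not> r < dist x a"
  proof
    assume "r < dist x a"
    moreover have "open (N \<inter> {x. r < dist x a})"
      by (intro open_Int N open_Collect_less continuous_intros)
    ultimately have "x \<in> interior W" using x N by (intro interiorI[of "N \<inter> {x. r < dist x a}"]) auto
    then show False using f by (simp add: frontier_def)
  qed
  moreover have "\<not> dist x a < r"
  proof
    assume "dist x a < r"
    moreover have "open (N \<inter> {x. dist x a < r})"
      by (intro open_Int N open_Collect_less continuous_intros)
    moreover have "y \<in> W \<Longrightarrow> y \<in> N \<Longrightarrow> r \<le> dist y a" for y using N(3) by blast
    then have "(N \<inter> {x. dist x a < r}) \<inter> W = {}" by force
    ultimately have "x \<notin> closure W" using x open_Int_closure_eq_empty by blast
    then show False using f by (simp add: frontier_def)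
  qed
  ultimately show "x \<in> sphere a r" by (simp add: dist_commute)
next
  assume s: "x \<in> sphere a r"
  then have "x \<in> W" using x N by (auto simp: dist_commute)
  moreover have "x \<notin> interior W"
  proof
    assume "x \<in> interior W"
    then have "x \<in> interior W \<inter> N" using x by simp
    moreover have "open (interior W \<inter> N)" using N by auto
    ultimately obtain e where e: "0 < e" "ball x e \<subseteq> interior W \<inter> N"
      using open_contains_ball by blast
    \<comment> \<open>Moving \<open>x\<close> towards \<open>a\<close> by the fraction
      \<open>t\<close> of the radius covers distance t r, at most e / 2, so the new point stays in
      the ball but lies inside the hole.\<close>
    define t where "t = min (e / (2 * r)) 1"
    have t: "0 < t" "t \<le> 1" "t * r < e" using e r by (auto simp: t_def min_def field_simps)
    let ?y = "a + (1 - t) *\<^sub>R (x - a)"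
    have nx: "norm (x - a) = r" using s by (simp add: dist_norm norm_minus_commute)
    have "x - ?y = t *\<^sub>R (x - a)" by (simp add: algebra_simps)
    then have "dist x ?y = t * r" unfolding dist_norm using nx t by simp
    then have "?y \<in> W \<inter> N" using e t interior_subset by fastforce
    moreover have "dist ?y a = (1 - t) * r" using nx t by (simp add: dist_norm)
    then have "dist ?y a < r" using t r by simp
    ultimately show False using N by auto
  qed
  ultimately show "x \<in> frontier W" using closure_subset by (auto simp: frontier_def)
qed

lemma boundary_saddle_outer_point: "boundary_saddle W H (outer_point z a r)"
proof -
  let ?p = "outer_point z a r" and ?D = "norm (a - z)"
  have D: "0 < ?D" using za by simp
  \<comment> \<open>An orthonormal frame: \<open>e\<close> points from \<open>z\<close> to
    \<open>a\<close>, and \<open>f\<close> is \<open>e\<close> after a quarter turn. The outer point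
    is at angle 0 on the circle.\<close>
  define e where "e = (1 / ?D) *\<^sub>R (a - z)"
  have ae: "a - z = ?D *\<^sub>R e" and ne: "norm e = 1" using D by (auto simp: e_def)
  have p: "?p = a + r *\<^sub>R e" by (simp add: outer_point_def e_def)
  have ee: "e \<bullet> e = 1" using ne by (simp add: norm_eq_1)
  define f :: "real^2" where "f = vector [- e$2, e$1]"
  have ef: "e \<bullet> f = 0" by (simp add: f_def inner_vec_def sum_2)
  have ff: "f \<bullet> f = 1" using ee by (simp add: f_def inner_vec_def sum_2)
  have ps: "?p \<in> sphere a r" using outer_point_in_sphere[OF r za] .
  \<comment> \<open>Squaring the distance keeps the defining function smooth even at the centre. Its
    gradient -2 (p - a) points into the hole, hence out of \<open>W\<close>.\<close>
  let ?g = "\<lambda>x. r\<^sup>2 - (norm (x - a))\<^sup>2"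
  have "smooth_boundary_at W ?p N ?g ((-2) *\<^sub>R (?p - a))"
    unfolding smooth_boundary_at_def
  proof (intro conjI smooth_on_norm_diff_sq)
    show "GDERIV ?g ?p :> (-2) *\<^sub>R (?p - a)"
      unfolding gderiv_def
      using has_derivative_diff[OF has_derivative_const has_derivative_norm_diff_sq, of "r\<^sup>2" a ?p]
      by simp
    show "?g ?p = 0" using ps by (simp add: dist_norm norm_minus_commute)
    show "(-2) *\<^sub>R (?p - a) \<noteq> 0" using r ne by (auto simp: p)
    show "W \<inter> N = {x \<in> N. ?g x \<le> 0}"
      unfolding N(3) using r by (auto simp: dist_norm abs_le_square_iff[symmetric])
  qed (use N ps in auto)
  moreover have pz: "?p - z = (r + ?D) *\<^sub>R e"
    using ae by (simp add: p algebra_simps)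
  have "6 *\<^sub>R (?p - z) \<noteq> 0"
  proof -
    have "r + ?D \<noteq> 0" using r D by linarith
    moreover have "e \<noteq> 0" using ne by auto
    ultimately show ?thesis unfolding pz by (simp only: scaleR_eq_0_iff) simp
  qed
  moreover have "(6 *\<^sub>R (?p - z)) \<bullet> ((-2) *\<^sub>R (?p - a)) < 0"
  proof -
    have "(6 *\<^sub>R (?p - z)) \<bullet> ((-2) *\<^sub>R (?p - a)) = - (12 * (r + ?D) * r)"
      unfolding pz using ee by (simp add: p algebra_simps)
    moreover have "0 < 12 * (r + ?D) * r" using r D by (intro mult_pos_pos add_pos_pos) auto
    ultimately show ?thesis by linarith
  qed
  moreover have "nondegenerate_max_on_boundary W H ?p"
  proof -
    define \<gamma> where "\<gamma> = (\<lambda>t. a + (cos t *\<^sub>R (r *\<^sub>R e) + sin t *\<^sub>R (r *\<^sub>R f)))"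
    have sph: "\<gamma> t \<in> sphere a r" for t
    proof -
      have "(norm (\<gamma> t - a))\<^sup>2 = r\<^sup>2 * ((cos t)\<^sup>2 + (sin t)\<^sup>2)"
        unfolding power2_norm_eq_inner using ee ef ff
        by (simp add: \<gamma>_def inner_add_left inner_add_right inner_commute[of f e]
            power2_eq_square distrib_left del: sin_cos_squared_add3)
      then have "(norm (\<gamma> t - a))\<^sup>2 = r\<^sup>2" by simp
      then have "norm (\<gamma> t - a) = r" using r by (simp add: power2_eq_iff_nonneg)
      then show ?thesis by (simp add: dist_norm norm_minus_commute)
    qed
    \<comment> \<open>As \<open>f\<close> is orthogonal to a - z, only the cosine term survives: the
      angle 0 is critical, with second derivative -6 r |a - z|.\<close>
    have Hg: "H \<circ> \<gamma> = (\<lambda>t. 6 * r * ?D * cos t + (3 * (r\<^sup>2 + ?D\<^sup>2) + k))"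
    proof
      fix t
      have "(\<gamma> t - a) \<bullet> (a - z) = ?D * r * cos t"
        using ee ef by (subst ae) (simp add: \<gamma>_def inner_add_left inner_commute[of f e])
      then show "(H \<circ> \<gamma>) t = 6 * r * ?D * cos t + (3 * (r\<^sup>2 + ?D\<^sup>2) + k)"
        unfolding H o_def using norm_sq_on_sphere[OF sph[of t], of z] by (simp add: algebra_simps)
    qed
    have "smooth_on \<gamma> {-1<..<1}" unfolding \<gamma>_def by (rule smooth_on_ellipse)
    moreover have "\<gamma> ` {-1<..<1} \<subseteq> frontier W" using sph N frontier_iff by blast
    moreover have "\<gamma> 0 = ?p" by (simp add: \<gamma>_def p)
    moreover have "(\<gamma> has_vector_derivative (r *\<^sub>R f)) (at 0)"
      using has_vector_derivative_ellipse[of a "r *\<^sub>R e" "r *\<^sub>R f" 0] by (simp add: \<gamma>_def)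
    moreover have "r *\<^sub>R f \<noteq> 0" using r ff by auto
    moreover have "\<forall>t\<in>{-1<..<1}. ((H \<circ> \<gamma>) has_real_derivative (- (6 * r * ?D) * sin t)) (at t)"
      unfolding Hg by (auto intro!: derivative_eq_intros)
    moreover have "((\<lambda>t. - (6 * r * ?D) * sin t) has_real_derivative (- (6 * r * ?D))) (at 0)"
      by (auto intro!: derivative_eq_intros)
    moreover have "- (6 * r * ?D) < 0" using r D by simp
    ultimately show ?thesis unfolding nondegenerate_max_on_boundary_def
      by (intro exI[of _ "1::real"] exI[of _ \<gamma>] exI[of _ "r *\<^sub>R f"]
          exI[of _ "\<lambda>t. - (6 * r * ?D) * sin t"] exI[of _ "- (6 * r * ?D)"]) auto
  qed
  ultimately show ?thesis unfolding boundary_saddle_def using gderiv_dist_sq[OF H] by blast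
qed

text \<open>The velocity \<open>u\<close> is orthogonal to p - a because the curve stays on the
  circle, and to p - z because \<open>p\<close> is critical. So p - a is parallel to a - z, which
  leaves two candidates; the inner one minimizes \<open>H\<close> on the circle and cannot be a
  strict maximum along the curve.\<close>

lemma nondegenerate_max_imp_outer_point:
  assumes p: "p \<in> sphere a r" and max: "nondegenerate_max_on_boundary W H p"
  shows "p = outer_point z a r"
proof -
  let ?D = "norm (a - z)"
  have D: "0 < ?D" using za by simp
  obtain e \<gamma> u d s where e: "0 < e" and fr: "\<gamma> ` {-e<..<e} \<subseteq> frontier W" and g0: "\<gamma> 0 = p"
    and du: "(\<gamma> has_vector_derivative u) (at 0)" and u: "u \<noteq> 0"
    and dH: "\<forall>t\<in>{-e<..<e}. ((H \<circ> \<gamma>) has_real_derivative d t) (at t)" and d0: "d 0 = 0"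
    and s: "(d has_real_derivative s) (at 0)" "s < 0"
    using max unfolding nondegenerate_max_on_boundary_def by blast
  \<comment> \<open>Continuity keeps the curve in \<open>N\<close> for small parameters, where
    \<open>frontier_iff\<close> applies.\<close>
  have "(\<gamma> \<longlongrightarrow> p) (nhds 0)"
    using has_vector_derivative_continuous[OF du] unfolding g0[symmetric]
    by (simp only: isCont_def tendsto_at_iff_tendsto_nhds)
  then have "\<forall>\<^sub>F t in nhds 0. \<gamma> t \<in> N"
    by (rule topological_tendstoD) (use N p in auto)
  then obtain e' where e': "0 < e'" "\<And>t. \<bar>t\<bar> < e' \<Longrightarrow> \<gamma> t \<in> N"
    unfolding eventually_nhds_metric by (auto simp: dist_norm)
  define \<epsilon> where "\<epsilon> = min e e'"
  have \<epsilon>: "0 < \<epsilon>" using e e' by (simp add: \<epsilon>_def)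
  have sph: "\<gamma> t \<in> sphere a r" if "\<bar>t\<bar> < \<epsilon>" for t
  proof -
    have "t \<in> {-e<..<e}" "\<gamma> t \<in> N" using that e'(2)[of t] by (auto simp: \<epsilon>_def)
    then show ?thesis using fr frontier_iff[of "\<gamma> t"] by blast
  qed
  have pau: "(p - a) \<bullet> u = 0"
  proof -
    have "((\<lambda>t. (norm (\<gamma> t - a))\<^sup>2) has_real_derivative (u \<bullet> (2 *\<^sub>R (p - a)))) (at 0)"
      using GDERIV_compose_has_vector_derivative[OF du, of "\<lambda>x. (norm (x - a))\<^sup>2"
          "2 *\<^sub>R (p - a)"] has_derivative_norm_diff_sq[of a p] g0
      unfolding gderiv_def by (simp only:)
    moreover have "\<forall>t. \<bar>0 - t\<bar> < \<epsilon> \<longrightarrow> (norm (\<gamma> 0 - a))\<^sup>2 = (norm (\<gamma> t - a))\<^sup>2"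
      using sph sph[of 0] \<epsilon> by (simp add: dist_norm norm_minus_commute)
    ultimately have "u \<bullet> (2 *\<^sub>R (p - a)) = 0"
      by (rule DERIV_local_const[OF _ \<epsilon>])
    then show ?thesis by (simp add: inner_commute)
  qed
  have pzu: "(p - z) \<bullet> u = 0"
  proof -
    have "((H \<circ> \<gamma>) has_real_derivative (u \<bullet> (6 *\<^sub>R (p - z)))) (at 0)"
      using GDERIV_compose_has_vector_derivative[OF du gderiv_dist_sq[OF H]] g0
      unfolding o_def by simp
    moreover have "((H \<circ> \<gamma>) has_real_derivative 0) (at 0)" using bspec[OF dH, of 0] d0 e by simp
    ultimately have "u \<bullet> (6 *\<^sub>R (p - z)) = 0" by (rule DERIV_unique)
    then show ?thesis by (simp add: inner_commute)
  qed
  \<comment> \<open>The difference of the two orthogonality relations.\<close>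
  have "(a - z) \<bullet> u = 0" "a - z \<noteq> 0" using za pau pzu by (auto simp: inner_diff_left)
  then obtain l where l: "p - a = l *\<^sub>R (a - z)"
    using ortho_same_imp_scaleR[OF pau _ u] by metis
  have "\<bar>l\<bar> * ?D = r" using p arg_cong[OF l, of norm] by (simp add: dist_norm norm_minus_commute)
  then have "\<bar>l\<bar> = r / ?D" using D by (simp add: field_simps)
  moreover have "l \<noteq> - (r / ?D)"
  proof
    assume l': "l = - (r / ?D)"
    have pz: "(p - a) \<bullet> (a - z) = - r * ?D"
      unfolding l l' using D by (simp add: power2_norm_eq_inner[symmetric] power2_eq_square)
    have ge: "H p \<le> H x" if x: "x \<in> sphere a r" for x
    proof -
      \<comment> \<open>Cauchy-Schwarz bounds the linear term on the circle from below by -r |a -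
        z|, the value attained at the inner point.\<close>
      have "\<bar>(x - a) \<bullet> (a - z)\<bar> \<le> r * ?D"
        using Cauchy_Schwarz_ineq2[of "x - a" "a - z"] x by (simp add: dist_norm norm_minus_commute)
      then show ?thesis
        using pz unfolding H norm_sq_on_sphere[OF x, of z] norm_sq_on_sphere[OF p, of z] by simp
    qed
    obtain \<delta> where \<delta>: "0 < \<delta>" "\<And>t. 0 < t \<Longrightarrow> t < \<delta> \<Longrightarrow> H (\<gamma> t) < H p"
      using second_derivative_test_right[OF e dH d0 s] g0 by auto
    define t where "t = min \<delta> \<epsilon> / 2"
    have "0 < t" "t < \<delta>" "\<bar>t\<bar> < \<epsilon>" using \<delta>(1) \<epsilon> by (auto simp: t_def)
    then show False using \<delta>(2)[of t] ge[OF sph[of t]] by simp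
  qed
  ultimately have "l = r / ?D" by linarith
  then show ?thesis using l by (simp add: outer_point_def algebra_simps)
qed

end

section \<open>Reduction to the center of gravity and assembly of the three holes\<close>

text \<open>Expanding each square around \<open>z\<close>, the linear terms cancel because the
  vectors from the three points to their center of gravity sum to zero.\<close>

lemma sum_dist_sq_centroid:
  fixes a b c x z :: "'a::real_inner"
  assumes "z = (1/3) *\<^sub>R (a + b + c)"
  shows "(norm (x - a))\<^sup>2 + (norm (x - b))\<^sup>2 + (norm (x - c))\<^sup>2 =
    3 * (norm (x - z))\<^sup>2 + ((norm (z - a))\<^sup>2 + (norm (z - b))\<^sup>2 + (norm (z - c))\<^sup>2)"
proof -
  have "(z - a) + (z - b) + (z - c) = 0"
    unfolding assms by (simp add: algebra_simps scaleR_left_distrib[symmetric])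
  then have "(x - z) \<bullet> (z - a) + (x - z) \<bullet> (z - b) + (x - z) \<bullet> (z - c) = 0"
    by (simp add: inner_add_right[symmetric])
  then show ?thesis
    using norm_diff_sq_split[of x a z] norm_diff_sq_split[of x b z] norm_diff_sq_split[of x c z]
    by linarith
qed

theorem proposition2:
  fixes a b c z :: "real^2"
    and rA rB rC RA RB RC :: real
    and H :: "real^2 \<Rightarrow> real"
    and W :: "(real^2) set"
  assumes z_eq: "z = (1/3) *\<^sub>R (a + b + c)"
    and H_eq: "H = (\<lambda>x. (norm (x - a))\<^sup>2 + (norm (x - b))\<^sup>2 + (norm (x - c))\<^sup>2)"
    and radii: "0 < rA" "rA < RA" "0 < rB" "rB < RB" "0 < rC" "rC < RC"
    and W_eq: "W = {x. rA \<le> dist x a \<and> dist x a \<le> RA \<and>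
                       rB \<le> dist x b \<and> dist x b \<le> RB \<and>
                       rC \<le> dist x c \<and> dist x c \<le> RC}"
    and disj: "cball a rA \<inter> cball b rB = {}"
              "cball a rA \<inter> cball c rC = {}"
              "cball b rB \<inter> cball c rC = {}"
    and contained: "cball a rA \<subseteq> interior (cball a RA \<inter> cball b RB \<inter> cball c RC)"
                   "cball b rB \<subseteq> interior (cball a RA \<inter> cball b RB \<inter> cball c RC)"
                   "cball c rC \<subseteq> interior (cball a RA \<inter> cball b RB \<inter> cball c RC)"
    and z_int: "z \<in> interior W"
  shows "is_arg_min H (\<lambda>x. x \<in> W) z \<and>
         card {p. saddle_point W H p} = 3 \<and>
         (\<exists>pA pB pC. outer_intersection z a rA pA \<and>
                     outer_intersection z b rB pB \<and>
                     outer_intersection z c rC pC \<and>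
                     {pA, pB, pC} = {p. boundary_saddle W H p} \<and>
                     {pA, pB, pC} = {p. saddle_point W H p})"
proof -
  define K where "K = cball a RA \<inter> cball b RB \<inter> cball c RC"
  define k where "k = (norm (z - a))\<^sup>2 + (norm (z - b))\<^sup>2 + (norm (z - c))\<^sup>2"
  have H: "H = (\<lambda>x. 3 * (norm (x - z))\<^sup>2 + k)"
    unfolding H_eq k_def by (rule ext, rule sum_dist_sq_centroid[OF z_eq])
  have W: "x \<in> W \<longleftrightarrow> x \<in> K \<and> rA \<le> dist x a \<and> rB \<le> dist x b \<and> rC \<le> dist x c" for x
    by (auto simp: W_eq K_def dist_commute)
  have zW: "z \<in> W" using z_int interior_subset by blast
  have za: "z \<noteq> a" "z \<noteq> b" "z \<noteq> c" using zW W radii by auto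
  have IK: "interior K \<subseteq> K" by (rule interior_subset)
  \<comment> \<open>Stated for arbitrary roles of the three centers, with the description of
    \<open>W\<close> as a premise, so that one proof serves all three holes.\<close>
  have hole: "hole W (interior K - cball b' s - cball c' t) a' z r k H"
    if "0 < r" "z \<noteq> a'" "cball a' r \<subseteq> interior K"
      "cball a' r \<inter> cball b' s = {}" "cball a' r \<inter> cball c' t = {}"
      "\<And>x. x \<in> W \<longleftrightarrow> x \<in> K \<and> r \<le> dist x a' \<and> s \<le> dist x b' \<and> t \<le> dist x c'"
    for a' b' c' r s t
  proof
    show "sphere a' r \<subseteq> interior K - cball b' s - cball c' t"
      using that(3-5) sphere_cball[of a' r] by blast
    show "W \<inter> (interior K - cball b' s - cball c' t) =
        {x \<in> interior K - cball b' s - cball c' t. r \<le> dist x a'}"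
      using IK by (auto simp: that(6) dist_commute)
  qed (use that H in \<open>auto intro!: open_Diff\<close>)
  interpret A: hole W "interior K - cball b rB - cball c rC" a z rA k H
    by (rule hole) (use radii za contained disj W in \<open>auto simp: K_def\<close>)
  interpret B: hole W "interior K - cball a rA - cball c rC" b z rB k H
    by (rule hole) (use radii za contained disj W in \<open>auto simp: K_def\<close>)
  interpret C: hole W "interior K - cball a rA - cball b rB" c z rC k H
    by (rule hole) (use radii za contained disj W in \<open>auto simp: K_def\<close>)
  let ?pA = "outer_point z a rA" and ?pB = "outer_point z b rB" and ?pC = "outer_point z c rC"
  have on_circle: "p \<in> sphere a rA \<union> sphere b rB \<union> sphere c rC" if p: "boundary_saddle W H p" for p
  proof (rule ccontr)
    assume n: "p \<notin> sphere a rA \<union> sphere b rB \<union> sphere c rC"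
    \<comment> \<open>Away from the small discs \<open>W\<close> coincides with the convex set
      \<open>K\<close>, which contains \<open>z\<close>. This handles smooth points and corners of
      the outer boundary alike.\<close>
    let ?N = "- cball a rA - cball b rB - cball c rC"
    have "p \<in> ?N" using boundary_saddle_inD[OF p] n by (auto simp: W dist_commute)
    moreover have "W \<inter> ?N = K \<inter> ?N" by (auto simp: W dist_commute)
    moreover have "convex K" by (auto simp: K_def intro!: convex_Int)
    moreover have "open ?N" by (auto intro!: open_Diff)
    ultimately have "\<not> boundary_saddle W H p"
      using no_boundary_saddle_locally_convex[OF H, of ?N p W K] zW W by blast
    then show False using p by simp
  qed
  have bs: "{p. boundary_saddle W H p} = {?pA, ?pB, ?pC}"
  proof (intro equalityI subsetI)
    fix p assume "p \<in> {p. boundary_saddle W H p}"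
    then have p: "boundary_saddle W H p" by simp
    then have "nondegenerate_max_on_boundary W H p" by (simp add: boundary_saddle_def)
    then show "p \<in> {?pA, ?pB, ?pC}"
      using on_circle[OF p] A.nondegenerate_max_imp_outer_point
        B.nondegenerate_max_imp_outer_point C.nondegenerate_max_imp_outer_point by blast
  qed (use A.boundary_saddle_outer_point B.boundary_saddle_outer_point
      C.boundary_saddle_outer_point in auto)
  have sp: "{p. saddle_point W H p} = {?pA, ?pB, ?pC}"
    using bs no_interior_saddle_dist_sq[OF H] by (simp add: saddle_point_def)
  \<comment> \<open>Disjointness of the small discs makes the three saddles distinct, so that the
    count is exactly 3.\<close>
  have "?pA \<in> cball a rA" "?pB \<in> cball b rB" "?pC \<in> cball c rC"
    using outer_point_in_sphere radii za sphere_cball by blast+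
  then have "?pA \<noteq> ?pB" "?pA \<noteq> ?pC" "?pB \<noteq> ?pC" using disj by auto
  then have "card {p. saddle_point W H p} = 3" unfolding sp by simp
  moreover have "is_arg_min H (\<lambda>x. x \<in> W) z" using zW by (simp add: is_arg_min_def H)
  ultimately show ?thesis
    using bs sp outer_intersection_outer_point radii za by metis
qed

end
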